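(* Let $f=(f_1,f_2,\dots)\in\ell_1$ with $\|f\|_{\ell_1}=1$ and let $W_f=\ker f\subset c$ be such that $W_f^*\simeq\ell_1$, $\frac12\leq|f_1|<1$ and $|f_j|<\frac12$ for every $j\geq 2$. If $\{e_n\}$ is the standard basis of $\ell_1$, then $$e_n\xrightarrow{\ \sigma(\ell_1,W_f)\ }\hat e,\qquad\text{where}\quad \hat e=\left(-\frac{f_2}{f_1},-\frac{f_3}{f_1},-\frac{f_4}{f_1},\dots\right).$$
   Context: All spaces are real. $c$ is the Banach space of convergent sequences $x=(x_1,x_2,\dots)$ with the supremum norm. For $x\in c$ put $x_0=\lim_{i\to\infty}x_i$. An element $f\in\ell_1$ acts on $c$ by $f(x)=\sum_{i=0}^{\infty}f_{i+1}x_i$ (so $f_1$ multiplies the limit $x_0$). $X\simeq Y$ means that $X$ and $Y$ are isometrically isomorphic. The identification of $\ell_1$ with $W_f^*$ used here, and hence the weak$^*$ topology $\sigma(\ell_1,W_f)$ on $\ell_1$, is given by the isometric isomorphism $\phi:\ell_1\to W_f^*$, $(\phi(y))(x)=\sum_{j=1}^{+\infty}x_jy_j$ for $y=(y_j)_{j\ge1}\in\ell_1$ and $x=(x_j)_{j\ge 1}\in W_f$. *)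

theory Defs
  imports "HOL-Analysis.Analysis"
begin

text \<open>
  Sequences are indexed from 0: the coordinate usually written \<open>x\<^sub>j\<close> (\<open>j \<ge> 1\<close>) is \<open>x (j - 1)\<close> here,
  for the elements of \<open>c\<close> and of \<open>\<ell>\<^sub>1\<close> alike. In particular \<open>f 0\<close> is the coefficient \<open>f\<^sub>1\<close>
  of the limit.
\<close>

definition l1 :: "(nat \<Rightarrow> real) set" where
  "l1 = {y. summable (\<lambda>j. \<bar>y j\<bar>)}"

definition l1_norm :: "(nat \<Rightarrow> real) \<Rightarrow> real" where
  "l1_norm y = (\<Sum>j. \<bar>y j\<bar>)"

definition std_basis :: "nat \<Rightarrow> nat \<Rightarrow> real" where
  "std_basis n = (\<lambda>j. if j = n then 1 else 0)"

text \<open>The norm of \<open>nat \<Rightarrow>\<^sub>C real\<close> is the supremum norm (\<open>nat\<close> is discrete, so this type is the space of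
  all bounded sequences), and \<open>c\<close> carries the restriction of it.\<close>

definition c_space :: "(nat \<Rightarrow>\<^sub>C real) set" where
  "c_space = {x. convergent (apply_bcontfun x)}"

text \<open>With 1-based indices: \<open>f(x) = f\<^sub>1 x\<^sub>0 + (\<Sum>i\<ge>1. f\<^sub>i\<^sub>+\<^sub>1 x\<^sub>i)\<close>, where \<open>x\<^sub>0 = lim x\<^sub>i\<close>.\<close>

definition act :: "(nat \<Rightarrow> real) \<Rightarrow> (nat \<Rightarrow>\<^sub>C real) \<Rightarrow> real" where
  "act f x = f 0 * lim (apply_bcontfun x) + (\<Sum>i. f (Suc i) * x i)"

definition W :: "(nat \<Rightarrow> real) \<Rightarrow> (nat \<Rightarrow>\<^sub>C real) set" where
  "W f = {x \<in> c_space. act f x = 0}"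

text \<open>The dual of a linear subspace \<open>S\<close>. A functional on \<open>S\<close> is represented by its extension by 0 to
  the whole type, so that the dual is closed under the pointwise operations.\<close>

definition dual :: "'a::real_normed_vector set \<Rightarrow> ('a \<Rightarrow> real) set" where
  "dual S = {g. (\<forall>x\<in>S. \<forall>y\<in>S. \<forall>a b. g (a *\<^sub>R x + b *\<^sub>R y) = a * g x + b * g y) \<and>
                (\<exists>K. \<forall>x\<in>S. \<bar>g x\<bar> \<le> K * norm x) \<and>
                (\<forall>x. x \<notin> S \<longrightarrow> g x = 0)}"

definition dual_norm :: "'a::real_normed_vector set \<Rightarrow> ('a \<Rightarrow> real) \<Rightarrow> real" where
  "dual_norm S g = (SUP x\<in>{x \<in> S. norm x \<le> 1}. \<bar>g x\<bar>)"

definition weak_star_topology :: "'a::real_normed_vector set \<Rightarrow> ('a \<Rightarrow> real) topology" where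
  "weak_star_topology S = topology_generated_by {{g \<in> dual S. g x \<in> U} | x U. x \<in> S \<and> open U}"

text \<open>Isometric isomorphisms between two normed spaces \<open>(V, p)\<close> and \<open>(Z, q)\<close> of real functions with
  pointwise operations; both \<open>\<ell>\<^sub>1\<close> and the duals above are of this kind.\<close>

definition isometric_isomorphism ::
  "('i \<Rightarrow> real) set \<Rightarrow> (('i \<Rightarrow> real) \<Rightarrow> real) \<Rightarrow> ('j \<Rightarrow> real) set \<Rightarrow> (('j \<Rightarrow> real) \<Rightarrow> real) \<Rightarrow>
   (('i \<Rightarrow> real) \<Rightarrow> ('j \<Rightarrow> real)) \<Rightarrow> bool" where
  "isometric_isomorphism V p Z q T \<longleftrightarrow>
     bij_betw T V Z \<and>
     (\<forall>u\<in>V. \<forall>v\<in>V. \<forall>a b. T (\<lambda>i. a * u i + b * v i) = (\<lambda>j. a * T u j + b * T v j)) \<and>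
     (\<forall>u\<in>V. q (T u) = p u)"

definition isometrically_isomorphic ::
  "('i \<Rightarrow> real) set \<Rightarrow> (('i \<Rightarrow> real) \<Rightarrow> real) \<Rightarrow> ('j \<Rightarrow> real) set \<Rightarrow> (('j \<Rightarrow> real) \<Rightarrow> real) \<Rightarrow> bool" where
  "isometrically_isomorphic V p Z q \<longleftrightarrow> (\<exists>T. isometric_isomorphism V p Z q T)"

definition \<phi> :: "(nat \<Rightarrow> real) \<Rightarrow> (nat \<Rightarrow> real) \<Rightarrow> (nat \<Rightarrow>\<^sub>C real) \<Rightarrow> real" where
  "\<phi> f y = (\<lambda>x. if x \<in> W f then \<Sum>j. x j * y j else 0)"

text \<open>\<open>\<sigma>(\<ell>\<^sub>1, W\<^sub>f)\<close>: the weak* topology of the dual of \<open>W f\<close>, transported to \<open>\<ell>\<^sub>1\<close> along \<open>\<phi> f\<close>.\<close>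

definition sigma_l1 :: "(nat \<Rightarrow> real) \<Rightarrow> (nat \<Rightarrow> real) topology" where
  "sigma_l1 f = pullback_topology l1 (\<phi> f) (weak_star_topology (W f))"

end

theory Submission
  imports Defs
begin

text \<open>On \<open>W f\<close> the identity \<open>act f x = 0\<close> solves for the limit: \<open>lim x = - (\<Sum>j. f (Suc j) * x j) / f 0\<close>.
  The left-hand side is the limit of the pairings of \<open>x\<close> with the basis vectors, and the right-hand
  side is the pairing of \<open>x\<close> with the claimed weak* limit.\<close>

text \<open>Testing on a subbasis suffices: the sets that \<open>g\<close> eventually enters if they
  contain \<open>l\<close> are closed under binary intersections, since two eventual statements can
  be conjoined, and under unions, since one member containing \<open>l\<close> is enough.\<close>

lemma limitin_topology_generated_by:
  assumes top: "l \<in> \<Union>\<B>"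
    and ev: "\<And>B. B \<in> \<B> \<Longrightarrow> l \<in> B \<Longrightarrow> eventually (\<lambda>n. g n \<in> B) F"
  shows "limitin (topology_generated_by \<B>) g l F"
proof -
  have "l \<in> U \<Longrightarrow> eventually (\<lambda>n. g n \<in> U) F" if "generate_topology_on \<B> U" for U
    using that
  proof (induction rule: generate_topology_on.induct)
    case (Int a b)
    then show ?case by (simp add: eventually_conj)
  next
    case (UN K)
    then obtain k where "k \<in> K" "l \<in> k" by auto
    then have "eventually (\<lambda>n. g n \<in> k) F" using UN.IH by blast
    then show ?case by eventually_elim (use \<open>k \<in> K\<close> in blast)
  qed (auto intro: ev)
  then show ?thesis
    using top by (auto simp: limitin_def openin_topology_generated_by_iff)
qed

text \<open>Open sets of the pullback are the traces on \<open>A\<close> of preimages under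
  \<open>h\<close>, so a neighbourhood of \<open>l\<close> comes from one of
  \<open>h l\<close>.\<close>

lemma limitin_pullback_topology:
  assumes "limitin T (\<lambda>n. h (g n)) (h l) F" and "l \<in> A" and "\<And>n. g n \<in> A"
  shows "limitin (pullback_topology A h T) g l F"
  using assms by (auto simp: limitin_def openin_pullback_topology topspace_pullback_topology)

text \<open>Each subbasic set constrains a single evaluation, so weak* convergence reduces to
  pointwise convergence on \<open>S\<close>.\<close>

lemma limitin_weak_star_topology:
  assumes "S \<noteq> {}" and "l \<in> dual S" and "\<And>n. g n \<in> dual S"
    and lim: "\<And>x. x \<in> S \<Longrightarrow> ((\<lambda>n. g n x) \<longlongrightarrow> l x) F"
  shows "limitin (weak_star_topology S) g l F"
  unfolding weak_star_topology_def
proof (rule limitin_topology_generated_by)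
  \<comment> \<open>The limit must lie in the topspace, the union of the subbasic sets; evaluation
    at any one point with \<open>U = UNIV\<close> already gives all of
    \<open>dual S\<close>.\<close>
  obtain x where "x \<in> S" using assms(1) by blast
  then have "{h \<in> dual S. h x \<in> UNIV} \<in> {{g \<in> dual S. g x \<in> U} | x U. x \<in> S \<and> open U}"
    by blast
  with assms(2) show "l \<in> \<Union>{{g \<in> dual S. g x \<in> U} | x U. x \<in> S \<and> open U}"
    by blast
next
  fix B
  assume "B \<in> {{g \<in> dual S. g x \<in> U} | x U. x \<in> S \<and> open U}" and "l \<in> B"
  then obtain x U where "x \<in> S" "open U" and B: "B = {h \<in> dual S. h x \<in> U}" and "l x \<in> U"
    by blast
  then have "eventually (\<lambda>n. g n x \<in> U) F"
    using lim topological_tendstoD by blast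
  then show "eventually (\<lambda>n. g n \<in> B) F"
    by eventually_elim (simp add: B assms(3))
qed

lemma abs_mult_bcontfun_le:
  fixes x :: "nat \<Rightarrow>\<^sub>C real"
  shows "\<bar>x j * a\<bar> \<le> norm x * \<bar>a\<bar>"
  using norm_bounded[of x j] by (simp add: abs_mult mult_right_mono)

lemma summable_abs_mult_l1:
  fixes x :: "nat \<Rightarrow>\<^sub>C real"
  assumes "y \<in> l1"
  shows "summable (\<lambda>j. \<bar>x j * y j\<bar>)"
proof (rule summable_comparison_test')
  show "summable (\<lambda>j. norm x * \<bar>y j\<bar>)"
    using assms by (simp add: l1_def)
  show "norm \<bar>x j * y j\<bar> \<le> norm x * \<bar>y j\<bar>" if "j \<ge> 0" for j
    using abs_mult_bcontfun_le[of x j "y j"] by simp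
qed

lemmas summable_mult_l1 = summable_rabs_cancel[OF summable_abs_mult_l1]

lemma suminf_mult_linear:
  fixes x x' :: "nat \<Rightarrow>\<^sub>C real"
  assumes "y \<in> l1"
  shows "(\<Sum>j. (a *\<^sub>R x + b *\<^sub>R x') j * y j) = a * (\<Sum>j. x j * y j) + b * (\<Sum>j. x' j * y j)"
proof -
  have "(\<lambda>j. (a *\<^sub>R x + b *\<^sub>R x') j * y j) sums (a * (\<Sum>j. x j * y j) + b * (\<Sum>j. x' j * y j))"
    using sums_add[OF sums_mult[OF summable_sums[OF summable_mult_l1[OF assms, of x]], of a]
        sums_mult[OF summable_sums[OF summable_mult_l1[OF assms, of x']], of b]]
    by (simp add: plus_bcontfun.rep_eq scaleR_bcontfun.rep_eq algebra_simps)
  then show ?thesis by (rule sums_unique[symmetric])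
qed

text \<open>Hoelder's inequality for the pairing; it supplies the bound \<open>K\<close> required by
  \<open>dual\<close>.\<close>

lemma abs_suminf_mult_le:
  fixes x :: "nat \<Rightarrow>\<^sub>C real"
  assumes "y \<in> l1"
  shows "\<bar>\<Sum>j. x j * y j\<bar> \<le> l1_norm y * norm x"
proof -
  have "\<bar>\<Sum>j. x j * y j\<bar> \<le> (\<Sum>j. \<bar>x j * y j\<bar>)"
    by (rule summable_rabs[OF summable_abs_mult_l1[OF assms]])
  also have "\<dots> \<le> (\<Sum>j. norm x * \<bar>y j\<bar>)"
    using assms by (intro suminf_le abs_mult_bcontfun_le summable_abs_mult_l1 summable_mult)
      (auto simp: l1_def)
  also have "\<dots> = l1_norm y * norm x"
    using assms by (simp add: l1_norm_def l1_def suminf_mult mult.commute)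
  finally show ?thesis .
qed

lemma l1_Suc: "f \<in> l1 \<Longrightarrow> (\<lambda>j. f (Suc j)) \<in> l1"
  using summable_Suc_iff[of "\<lambda>j. \<bar>f j\<bar>"] by (simp add: l1_def)

lemma l1_divide: "y \<in> l1 \<Longrightarrow> (\<lambda>j. - y j / a) \<in> l1"
  by (simp add: l1_def summable_divide)

lemma std_basis_sums: "(\<lambda>j. x j * std_basis n j) sums x n"
proof -
  have "(\<lambda>j. x j * std_basis n j) = (\<lambda>j. if j = n then x j else 0)"
    by (auto simp: std_basis_def)
  then show ?thesis using sums_single[of n x] by simp
qed

lemma std_basis_in_l1: "std_basis n \<in> l1"
proof -
  have "(\<lambda>j. \<bar>std_basis n j\<bar>) = (\<lambda>j. if j = n then 1 else 0)"
    by (auto simp: std_basis_def)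
  then show ?thesis by (simp add: l1_def)
qed

lemma zero_in_W: "0 \<in> W f"
proof -
  have "apply_bcontfun (0 :: nat \<Rightarrow>\<^sub>C real) = (\<lambda>_. 0)" by (auto simp: zero_bcontfun.rep_eq)
  then show ?thesis by (simp add: W_def c_space_def act_def convergent_const)
qed

lemma c_space_LIMSEQ: "x \<in> c_space \<Longrightarrow> apply_bcontfun x \<longlonglongrightarrow> lim (apply_bcontfun x)"
  by (simp add: c_space_def convergent_LIMSEQ_iff)

text \<open>Since \<open>\<phi> f y\<close> is set to 0 off \<open>W f\<close>, its linearity
  requires linear combinations to stay inside \<open>W f\<close>.\<close>

lemma W_linear:
  assumes "f \<in> l1" and "x \<in> W f" and "y \<in> W f"
  shows "a *\<^sub>R x + b *\<^sub>R y \<in> W f"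
proof -
  let ?z = "a *\<^sub>R x + b *\<^sub>R y"
  \<comment> \<open>This one limit yields both membership in \<open>c_space\<close> and linearity of
    \<open>lim\<close>.\<close>
  have "apply_bcontfun ?z \<longlonglongrightarrow> a * lim (apply_bcontfun x) + b * lim (apply_bcontfun y)"
    unfolding plus_bcontfun.rep_eq scaleR_bcontfun.rep_eq real_scaleR_def
    using assms by (intro tendsto_intros c_space_LIMSEQ) (auto simp: W_def)
  then have conv: "?z \<in> c_space"
    and lim: "lim (apply_bcontfun ?z) = a * lim (apply_bcontfun x) + b * lim (apply_bcontfun y)"
    by (auto simp: c_space_def convergent_def limI)
  have "act f ?z = a * act f x + b * act f y"
    using suminf_mult_linear[OF l1_Suc[OF assms(1)], of a x b y]
    unfolding act_def lim by (simp only: mult.commute[of "f (Suc _)"] distrib_left mult.left_commute)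
  with assms conv show ?thesis by (simp add: W_def)
qed

lemma \<phi>_in_dual:
  assumes "f \<in> l1" and "y \<in> l1"
  shows "\<phi> f y \<in> dual (W f)"
proof -
  have "\<phi> f y (a *\<^sub>R x + b *\<^sub>R x') = a * \<phi> f y x + b * \<phi> f y x'"
    if "x \<in> W f" and "x' \<in> W f" for x x' a b
    using that W_linear[OF assms(1)] suminf_mult_linear[OF assms(2)] by (simp only: \<phi>_def if_True)
  moreover have "\<bar>\<phi> f y x\<bar> \<le> l1_norm y * norm x" if "x \<in> W f" for x
    using that abs_suminf_mult_le[OF assms(2)] by (simp add: \<phi>_def)
  moreover have "\<phi> f y x = 0" if "x \<notin> W f" for x
    using that by (simp add: \<phi>_def)
  ultimately show ?thesis unfolding dual_def by blast
qed

lemma \<phi>_eq_lim: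
  assumes "f \<in> l1" and "f 0 \<noteq> 0" and "x \<in> W f"
  shows "\<phi> f (\<lambda>j. - f (Suc j) / f 0) x = lim (apply_bcontfun x)"
proof -
  \<comment> \<open>With the constant factor pulled out, the remaining series is the one in
    \<open>act f x\<close>, up to the order of the factors.\<close>
  have "(\<lambda>j. x j * (- f (Suc j) / f 0)) = (\<lambda>j. (- 1 / f 0) * (x j * f (Suc j)))"
    by auto
  then have eq: "\<phi> f (\<lambda>j. - f (Suc j) / f 0) x = (- 1 / f 0) * (\<Sum>j. x j * f (Suc j))"
    using assms(3) suminf_mult[OF summable_mult_l1[OF l1_Suc[OF assms(1)]]] by (simp only: \<phi>_def if_True)
  have "f 0 * lim (apply_bcontfun x) + (\<Sum>j. x j * f (Suc j)) = 0"
    using assms(3) by (simp add: W_def act_def mult.commute)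
  then show ?thesis unfolding eq using assms(2) by (simp add: field_simps)
qed

theorem theorem4p3:
  fixes f :: "nat \<Rightarrow> real"
  assumes "f \<in> l1"
    and "l1_norm f = 1"
    and "isometrically_isomorphic (dual (W f)) (dual_norm (W f)) l1 l1_norm"
    and "1/2 \<le> \<bar>f 0\<bar>" and "\<bar>f 0\<bar> < 1"
    and "\<And>j. j \<ge> 1 \<Longrightarrow> \<bar>f j\<bar> < 1/2"
  shows "limitin (sigma_l1 f) std_basis (\<lambda>j. - f (Suc j) / f 0) sequentially"
  unfolding sigma_l1_def
proof (intro limitin_pullback_topology limitin_weak_star_topology)
  show hat: "(\<lambda>j. - f (Suc j) / f 0) \<in> l1"
    by (intro l1_divide l1_Suc assms(1))
  show "\<phi> f (\<lambda>j. - f (Suc j) / f 0) \<in> dual (W f)"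
    by (rule \<phi>_in_dual[OF assms(1) hat])
  show "\<phi> f (std_basis n) \<in> dual (W f)" for n
    by (rule \<phi>_in_dual[OF assms(1) std_basis_in_l1])
  show "std_basis n \<in> l1" for n
    by (rule std_basis_in_l1)
  show "W f \<noteq> {}"
    using zero_in_W by blast
  show "(\<lambda>n. \<phi> f (std_basis n) x) \<longlonglongrightarrow> \<phi> f (\<lambda>j. - f (Suc j) / f 0) x" if x: "x \<in> W f" for x
  proof -
    \<comment> \<open>The lower bound on \<open>\<bar>f 0\<bar>\<close> makes the division by
      \<open>f 0\<close> legitimate.\<close>
    have "f 0 \<noteq> 0" using assms(4) by auto
    \<comment> \<open>Pairing with a basis vector reads off a coordinate, so the goal becomes the
      convergence of \<open>x\<close> itself to its limit.\<close>
    moreover have "\<phi> f (std_basis n) x = x n" for n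
      using x sums_unique[OF std_basis_sums[of x n]] by (simp add: \<phi>_def)
    ultimately show ?thesis
      using c_space_LIMSEQ[of x] x \<phi>_eq_lim[OF assms(1) _ x] by (simp add: W_def)
  qed
qed

end
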